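(* For every $N\in\{U,I,C,T,S\}$ and any two BCCSP processes $p,q$: $p\sqsubseteq_{NS}q$ if and only if $\mathit{BGO}_N(p)\subseteq\mathit{BGO}_N(q)$.
   Context: BCCSP processes over a set $\mathit{Act}$: $p ::= \mathbf{0}\mid ap\mid p+q$; transitions $ap\xrightarrow{a}p$, and $p\xrightarrow{a}p'$ implies $p+q\xrightarrow{a}p'$ and $q+p\xrightarrow{a}p'$; $p\overset{\alpha}{\Rightarrow}q$ for sequences. $I(p)=\{a\mid\exists p'.\,p\xrightarrow{a}p'\}$; $T(p)=\{\alpha\mid\exists p'.\,p\overset{\alpha}{\Rightarrow}p'\}$. For a relation $N$ on processes, an $N$-constrained simulation is a relation $R$ such that $pRq$ implies $pNq$ and, for every $p\xrightarrow{a}p'$, there is $q\xrightarrow{a}q'$ with $p'Rq'$; $p\sqsubseteq_{NS}q$ iff $pRq$ for some such $R$. Constraints: $U$ is the universal relation; $pIq\iff I(p)=I(q)$; $pCq\iff (I(p)=\emptyset\iff I(q)=\emptyset)$; $pTq\iff T(p)=T(q)$; $pSq\iff p\sqsubseteq_{US}q$ and $q\sqsubseteq_{US}p$ (simulation equivalence). Local observations: $L_U(p)=\cdot$ (a single constant); $L_I(p)=I(p)$; $L_C(p)=\mathit{true}$ if $I(p)=\emptyset$ and $\mathit{false}$ otherwise; $L_T(p)=T(p)$; $L_S(p)$ is the equivalence class of $p$ under simulation equivalence. Branching general observations: finite trees $\langle l,S\rangle$ with $l$ a local observation and $S$ a finite set of pairs $(a,b)$, $a\in\mathit{Act}$, $b$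 a branching observation. $\mathit{BGO}_N(p)$ is the (inductively defined) set of all $\langle L_N(p),S\rangle$ with $S$ a finite subset of $\{(a,b)\mid p\xrightarrow{a}p',\ b\in\mathit{BGO}_N(p')\}$. *)

theory Defs
  imports Main "HOL-Library.FSet"
begin

text \<open>The set of actions is the type variable \<open>'a\<close>; it may be infinite.\<close>

datatype 'a proc =
    Zero
  | Prefix 'a "'a proc"
  | Choice "'a proc" "'a proc"

inductive step :: "'a proc \<Rightarrow> 'a \<Rightarrow> 'a proc \<Rightarrow> bool" where
  prefix: "step (Prefix a p) a p"
| choice_left: "step p a p' \<Longrightarrow> step (Choice p q) a p'"
| choice_right: "step p a p' \<Longrightarrow> step (Choice q p) a p'"

inductive steps :: "'a proc \<Rightarrow> 'a list \<Rightarrow> 'a proc \<Rightarrow> bool" where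
  refl: "steps p [] p"
| step: "step p a p' \<Longrightarrow> steps p' as q \<Longrightarrow> steps p (a # as) q"

definition initials :: "'a proc \<Rightarrow> 'a set" where
  "initials p = {a. \<exists>p'. step p a p'}"

definition traces :: "'a proc \<Rightarrow> 'a list set" where
  "traces p = {as. \<exists>p'. steps p as p'}"

definition constrained_simulation ::
  "('a proc \<Rightarrow> 'a proc \<Rightarrow> bool) \<Rightarrow> ('a proc \<Rightarrow> 'a proc \<Rightarrow> bool) \<Rightarrow> bool" where
  "constrained_simulation N R \<longleftrightarrow>
     (\<forall>p q. R p q \<longrightarrow>
        N p q \<and> (\<forall>a p'. step p a p' \<longrightarrow> (\<exists>q'. step q a q' \<and> R p' q')))"

definition constrained_sim_le ::
  "('a proc \<Rightarrow> 'a proc \<Rightarrow> bool) \<Rightarrow> 'a proc \<Rightarrow> 'a proc \<Rightarrow> bool" where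
  "constrained_sim_le N p q \<longleftrightarrow> (\<exists>R. constrained_simulation N R \<and> R p q)"

definition universal_rel :: "'a proc \<Rightarrow> 'a proc \<Rightarrow> bool" where
  "universal_rel p q \<longleftrightarrow> True"

definition sim_equiv :: "'a proc \<Rightarrow> 'a proc \<Rightarrow> bool" where
  "sim_equiv p q \<longleftrightarrow>
     constrained_sim_le universal_rel p q \<and> constrained_sim_le universal_rel q p"

datatype constraint = N_U | N_I | N_C | N_T | N_S

fun constraint_rel :: "constraint \<Rightarrow> 'a proc \<Rightarrow> 'a proc \<Rightarrow> bool" where
  "constraint_rel N_U p q = universal_rel p q"
| "constraint_rel N_I p q = (initials p = initials q)"
| "constraint_rel N_C p q = (initials p = {} \<longleftrightarrow> initials q = {})"
| "constraint_rel N_T p q = (traces p = traces q)"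
| "constraint_rel N_S p q = sim_equiv p q"

text \<open>
  One type collects the local observations of all five constraints. The argument of
  \<open>Obs_S\<close> is an equivalence class of processes.
\<close>

datatype 'a local_obs =
    Obs_U
  | Obs_I "'a set"
  | Obs_C bool
  | Obs_T "'a list set"
  | Obs_S "'a proc set"

fun local_observation :: "constraint \<Rightarrow> 'a proc \<Rightarrow> 'a local_obs" where
  "local_observation N_U p = Obs_U"
| "local_observation N_I p = Obs_I (initials p)"
| "local_observation N_C p = Obs_C (initials p = {})"
| "local_observation N_T p = Obs_T (traces p)"
| "local_observation N_S p = Obs_S {q. sim_equiv p q}"

datatype 'a branching_obs =
  Branch "'a local_obs" "('a \<times> 'a branching_obs) fset"

inductive has_bgo :: "constraint \<Rightarrow> 'a proc \<Rightarrow> 'a branching_obs \<Rightarrow> bool"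
  for N :: constraint where
  "(\<And>a b. (a, b) |\<in>| S \<Longrightarrow> \<exists>p'. step p a p' \<and> has_bgo N p' b)
     \<Longrightarrow> has_bgo N p (Branch (local_observation N p) S)"

definition BGO :: "constraint \<Rightarrow> 'a proc \<Rightarrow> 'a branching_obs set" where
  "BGO N p = {b. has_bgo N p b}"

end

theory Submission
  imports Defs
begin

text \<open>
  Inclusion of observation sets is itself an \<open>N\<close>-constrained simulation: processes are finitely
  branching, and observations of one process have the same root label, so they can be merged by
  uniting their sets of branches. If \<open>p\<close> has an \<open>a\<close>-successor \<open>p'\<close> matched by none of the
  finitely many \<open>a\<close>-successors of \<open>q\<close>, then merging one distinguishing observation of \<open>p'\<close>
  per successor yields an observation of \<open>p'\<close> that none of them admits.
\<close>

lemma constrained_sim_le_refl: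
  assumes "\<And>p. N p p"
  shows "constrained_sim_le N p p"
  unfolding constrained_sim_le_def constrained_simulation_def
  using assms by (intro exI[of _ "(=)"]) auto

text \<open>The relational composite of two \<open>N\<close>-constrained simulations is again one:
  matching moves pass through the middle process, and transitivity of \<open>N\<close> keeps the
  related pairs inside \<open>N\<close>.\<close>

lemma constrained_sim_le_trans:
  assumes "transp N" "constrained_sim_le N p q" "constrained_sim_le N q r"
  shows "constrained_sim_le N p r"
proof -
  obtain R S where R: "constrained_simulation N R" "R p q"
    and S: "constrained_simulation N S" "S q r"
    using assms(2,3) unfolding constrained_sim_le_def by blast
  have "constrained_simulation N (R OO S)"
    unfolding constrained_simulation_def
  proof (intro allI impI conjI)
    fix x z assume "(R OO S) x z"
    then obtain y where y: "R x y" "S y z" by blast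
    then show "N x z"
      using R(1) S(1) assms(1) unfolding constrained_simulation_def by (meson transpD)
    fix a x' assume "step x a x'"
    then show "\<exists>z'. step z a z' \<and> (R OO S) x' z'"
      using y R(1) S(1) unfolding constrained_simulation_def by (meson relcomppI)
  qed
  then show ?thesis
    using R(2) S(2) unfolding constrained_sim_le_def by blast
qed

lemma equivp_sim_equiv: "equivp sim_equiv"
proof (rule equivpI)
  show "reflp sim_equiv"
    by (auto simp: reflp_def sim_equiv_def universal_rel_def intro: constrained_sim_le_refl)
  show "symp sim_equiv"
    by (auto simp: symp_def sim_equiv_def)
  have "transp universal_rel"
    by (simp add: transp_def universal_rel_def)
  then show "transp sim_equiv"
    by (intro transpI) (auto simp: sim_equiv_def intro: constrained_sim_le_trans)
qed

text \<open>Only \<open>N_S\<close> needs an argument: two elements are related by an equivalence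
  exactly when their classes coincide.\<close>

lemma constraint_rel_iff_local_observation:
  "constraint_rel N p q \<longleftrightarrow> local_observation N p = local_observation N q"
proof (cases N)
  case N_S
  have "sim_equiv p q \<longleftrightarrow> {r. sim_equiv p r} = {r. sim_equiv q r}"
    using equivp_sim_equiv[unfolded equivp_def, rule_format, of p q] by auto
  then show ?thesis using N_S by simp
qed (auto simp: universal_rel_def)

lemma finite_successors: "finite {p'. step p a p'}"
proof (induction p)
  case Zero
  have "{p'. step Zero a p'} = {}" by (auto elim: step.cases)
  then show ?case by (simp del: Collect_empty_eq)
next
  case (Prefix b p)
  have "{p'. step (Prefix b p) a p'} \<subseteq> {p}" by (auto elim: step.cases)
  then show ?case by (rule finite_subset) simp
next
  case (Choice p q)
  have "{p'. step (Choice p q) a p'} \<subseteq> {p'. step p a p'} \<union> {p'. step q a p'}"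
    by (auto elim: step.cases)
  then show ?case by (rule finite_subset) (use Choice in simp)
qed

lemma has_bgo_Branch_iff:
  "has_bgo N p (Branch l S) \<longleftrightarrow>
     l = local_observation N p \<and> (\<forall>a b. (a, b) |\<in>| S \<longrightarrow> (\<exists>p'. step p a p' \<and> has_bgo N p' b))"
  by (subst has_bgo.simps) auto

text \<open>Induction on the derivation of the observation; \<open>q\<close> stays arbitrary because
  the hypothesis for a branch is applied to the successor of \<open>q\<close> that \<open>R\<close>
  provides.\<close>

lemma has_bgo_mono:
  assumes R: "constrained_simulation (constraint_rel N) R"
  shows "has_bgo N p b \<Longrightarrow> R p q \<Longrightarrow> has_bgo N q b"
proof (induction p b arbitrary: q rule: has_bgo.induct)
  case (1 S p)
  have "local_observation N p = local_observation N q"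
    using R \<open>R p q\<close>
    unfolding constrained_simulation_def constraint_rel_iff_local_observation by blast
  moreover have "\<exists>q'. step q a q' \<and> has_bgo N q' b" if "(a, b) |\<in>| S" for a b
    using 1 that R unfolding constrained_simulation_def by meson
  ultimately show ?case by (simp add: has_bgo_Branch_iff)
qed

lemma BGO_separation:
  assumes "finite Q" "\<And>q. q \<in> Q \<Longrightarrow> \<not> BGO N p \<subseteq> BGO N q"
  obtains b where "b \<in> BGO N p" "\<And>q. q \<in> Q \<Longrightarrow> b \<notin> BGO N q"
proof -
  from assms have "\<exists>b \<in> BGO N p. \<forall>q \<in> Q. b \<notin> BGO N q"
  proof (induction Q)
    case empty
    \<comment> \<open>With nothing to separate from, any observation will do; the branchless one
      always exists.\<close>
    have "has_bgo N p (Branch (local_observation N p) {||})"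
      by (simp add: has_bgo_Branch_iff)
    then show ?case by (auto simp: BGO_def)
  next
    case (insert r Q)
    let ?l = "local_observation N p"
    obtain b where b: "has_bgo N p b" "\<forall>q \<in> Q. \<not> has_bgo N q b"
      using insert unfolding BGO_def by auto
    obtain c where c: "has_bgo N p c" "\<not> has_bgo N r c"
      using insert.prems[of r] unfolding BGO_def by auto
    obtain S T where ST: "b = Branch ?l S" "c = Branch ?l T"
      using b(1) c(1) by (metis has_bgo.cases)
    \<comment> \<open>The requirements on branches are independent of each other, and a
      \<open>q\<close> with root label other than \<open>?l\<close> admits none of the three
      trees.\<close>
    have "has_bgo N q (Branch ?l (S |\<union>| T)) \<longleftrightarrow> has_bgo N q b \<and> has_bgo N q c" for q
      by (auto simp: ST has_bgo_Branch_iff)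
    then show ?case
      using b c by (intro bexI[of _ "Branch ?l (S |\<union>| T)"]) (auto simp: BGO_def)
  qed
  then show thesis using that by blast
qed

lemma constrained_simulation_BGO_subset:
  "constrained_simulation (constraint_rel N) (\<lambda>p q. BGO N p \<subseteq> BGO N q)"
  unfolding constrained_simulation_def
proof (intro allI impI conjI)
  fix p q :: "'a proc"
  let ?l = "local_observation N p"
  assume sub: "BGO N p \<subseteq> BGO N q"
  \<comment> \<open>The branchless tree records only the root label, so its membership in
    \<open>BGO N q\<close> forces the labels of \<open>p\<close> and \<open>q\<close> to
    agree.\<close>
  have "Branch ?l {||} \<in> BGO N p"
    by (simp add: BGO_def has_bgo_Branch_iff)
  then have "Branch ?l {||} \<in> BGO N q" using sub by blast
  then show "constraint_rel N p q"
    by (simp add: BGO_def has_bgo_Branch_iff constraint_rel_iff_local_observation)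
  fix a p' assume p': "step p a p'"
  show "\<exists>q'. step q a q' \<and> BGO N p' \<subseteq> BGO N q'"
  proof (rule ccontr)
    assume "\<not> ?thesis"
    then obtain b where b: "b \<in> BGO N p'" "\<And>q'. step q a q' \<Longrightarrow> b \<notin> BGO N q'"
      using BGO_separation[OF finite_successors[of q a]] by (metis mem_Collect_eq)
    \<comment> \<open>Prefixing \<open>b\<close> with the move \<open>a\<close> turns it into an
      observation of \<open>p\<close>; in \<open>q\<close> it would need an
      \<open>a\<close>-successor admitting \<open>b\<close>.\<close>
    have "Branch ?l {|(a, b)|} \<in> BGO N p"
      using p' b(1) by (auto simp: BGO_def has_bgo_Branch_iff)
    then have "Branch ?l {|(a, b)|} \<in> BGO N q" using sub by blast
    then show False using b(2) by (auto simp: BGO_def has_bgo_Branch_iff)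
  qed
qed

theorem theorem4p9:
  fixes N :: constraint and p q :: "'a proc"
  shows "constrained_sim_le (constraint_rel N) p q \<longleftrightarrow> BGO N p \<subseteq> BGO N q"
proof
  assume "constrained_sim_le (constraint_rel N) p q"
  then show "BGO N p \<subseteq> BGO N q"
    unfolding constrained_sim_le_def BGO_def by (blast intro: has_bgo_mono)
next
  assume "BGO N p \<subseteq> BGO N q"
  then show "constrained_sim_le (constraint_rel N) p q"
    unfolding constrained_sim_le_def using constrained_simulation_BGO_subset by blast
qed

end
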